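(* For every $n\ge1$ let $\theta_{0,n}\in\Theta_n$ be given, equip $\Theta_n$ with its uniform prior $\Pi_n$, and define $b_n=|\Theta_n|^{-1}=\bigl(\tfrac12\binom{2n}{n}\bigr)^{-1}$. Let $D_n$ be a sequence of credible sets (set-valued maps from the sample space $\mathscr X_n$ to subsets of $\Theta_n$) such that $$\Pi(D_n(X^n)|X^n)\ge1-a_n$$ for some sequence $(a_n)$, $0\le a_n\le1$, with $a_n=o(b_n)$. Then $$P_{\theta_{0,n},n}\bigl(\theta_{0,n}\in D_n(X^n)\bigr)\ge1-b_n^{-1}a_n .$$
   Context: Planted bi-section model. For $n\ge1$, $\Theta_n'$ is the set of $\theta'\in\{0,1\}^{2n}$ with exactly $n$ zeros and $n$ ones. Let $\neg\theta'$ denote component-wise negation, let $\sim_n$ be the equivalence relation identifying $\theta'$ with $\neg\theta'$, and let $\Theta_n=\Theta_n'/\sim_n$. Given $p_n,q_n\in(0,1)$ and $\theta\in\Theta_n$ with representative $\theta'$, $P_{\theta,n}$ is the law of the random simple undirected graph $X^n$ (no loops) on vertices $\{1,\dots,2n\}$, with adjacency indicators $X_{ij}$ ($i<j$), whose edges occur independently with $P_{\theta,n}(X_{ij}=1)=p_n$ if $\theta'_i=\theta'_j$ and $=q_n$ if $\theta'_i\ne\theta'_j$ (independent of the representative). $\mathscr X_n$ is the finite set of such graphs. Let $p_{\theta,n}(x^n)=P_{\theta,n}(X^n=x^n)$. With the uniform prior on $\Theta_n$, the posterior is, for $A\subset\Theta_n$, $$\Pi(A|X^n)=\sum_{\theta\in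 A}p_{\theta,n}(X^n)\Big/\sum_{\theta\in\Theta_n}p_{\theta,n}(X^n).$$ The credible-level inequality is understood to hold almost surely under the prior predictive distribution $P_n^{\Pi}=|\Theta_n|^{-1}\sum_{\theta\in\Theta_n}P_{\theta,n}$. *)

theory Defs
  imports "HOL-Probability.Probability" "HOL-Library.Landau_Symbols"
begin

definition Theta_rep :: "nat \<Rightarrow> (nat \<Rightarrow> nat) set" where
  "Theta_rep n = {t \<in> {1..2 * n} \<rightarrow>\<^sub>E {0, 1}.
     card {i \<in> {1..2 * n}. t i = 0} = n \<and> card {i \<in> {1..2 * n}. t i = 1} = n}"

definition neg_rep :: "nat \<Rightarrow> (nat \<Rightarrow> nat) \<Rightarrow> (nat \<Rightarrow> nat)" where
  "neg_rep n t = restrict (\<lambda>i. 1 - t i) {1..2 * n}"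

definition sim :: "nat \<Rightarrow> ((nat \<Rightarrow> nat) \<times> (nat \<Rightarrow> nat)) set" where
  "sim n = {(t, u). t \<in> Theta_rep n \<and> u \<in> Theta_rep n \<and> (u = t \<or> u = neg_rep n t)}"

definition Theta :: "nat \<Rightarrow> (nat \<Rightarrow> nat) set set" where
  "Theta n = Theta_rep n // sim n"

definition vertex_pairs :: "nat \<Rightarrow> (nat \<times> nat) set" where
  "vertex_pairs n = {(i, j). 1 \<le> i \<and> i < j \<and> j \<le> 2 * n}"

text \<open>A simple undirected graph on the vertices \<open>{1..2 * n}\<close> is identified with its set of
  edges, an edge being a two-element set of vertices.\<close>

definition graph_of :: "nat \<Rightarrow> (nat \<times> nat \<Rightarrow> bool) \<Rightarrow> nat set set" where
  "graph_of n X = {{i, j} |i j. (i, j) \<in> vertex_pairs n \<and> X (i, j)}"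

definition graphs :: "nat \<Rightarrow> nat set set set" where
  "graphs n = Pow {e. e \<subseteq> {1..2 * n} \<and> card e = 2}"

definition graph_law_rep :: "nat \<Rightarrow> real \<Rightarrow> real \<Rightarrow> (nat \<Rightarrow> nat) \<Rightarrow> nat set set pmf" where
  "graph_law_rep n p q t = map_pmf (graph_of n)
     (Pi_pmf (vertex_pairs n) False
        (\<lambda>(i, j). bernoulli_pmf (if t i = t j then p else q)))"

text \<open>The choice of the representative is immaterial; see \<open>graph_law_eq\<close> below.\<close>

definition graph_law :: "nat \<Rightarrow> real \<Rightarrow> real \<Rightarrow> (nat \<Rightarrow> nat) set \<Rightarrow> nat set set pmf" where
  "graph_law n p q \<theta> = graph_law_rep n p q (SOME t. t \<in> \<theta>)"

definition posterior ::
  "nat \<Rightarrow> real \<Rightarrow> real \<Rightarrow> nat set set \<Rightarrow> (nat \<Rightarrow> nat) set set \<Rightarrow> real" where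
  "posterior n p q x A =
     (\<Sum>\<theta>\<in>A. pmf (graph_law n p q \<theta>) x) / (\<Sum>\<theta>\<in>Theta n. pmf (graph_law n p q \<theta>) x)"

definition prior_predictive :: "nat \<Rightarrow> real \<Rightarrow> real \<Rightarrow> nat set set pmf" where
  "prior_predictive n p q = pmf_of_set (Theta n) \<bind> graph_law n p q"

definition b_seq :: "nat \<Rightarrow> real" where
  "b_seq n = inverse (real (card (Theta n)))"

lemma finite_Theta_rep: "finite (Theta_rep n)"
  unfolding Theta_rep_def by (rule finite_subset[of _ "{1..2 * n} \<rightarrow>\<^sub>E {0, 1}"]) (auto intro!: finite_PiE)

lemma Theta_rep_values:
  assumes "t \<in> Theta_rep n" "i \<in> {1..2 * n}" shows "t i = 0 \<or> t i = 1"
proof -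
  have "t \<in> {1..2 * n} \<rightarrow>\<^sub>E {0, 1}" using assms(1) unfolding Theta_rep_def by blast
  from PiE_mem[OF this assms(2)] show ?thesis by blast
qed

lemma neg_rep_in:
  assumes "t \<in> Theta_rep n" shows "neg_rep n t \<in> Theta_rep n"
proof -
  have t: "t i = 0 \<or> t i = 1" if "i \<in> {1..2*n}" for i
    using Theta_rep_values[OF assms that] .
  have v: "neg_rep n t i = 0 \<longleftrightarrow> t i = 1" "neg_rep n t i = 1 \<longleftrightarrow> t i = 0"
    if "i \<in> {1..2*n}" for i
    using t[OF that] that by (auto simp: neg_rep_def)
  have "{i \<in> {1..2 * n}. neg_rep n t i = 0} = {i \<in> {1..2 * n}. t i = 1}"
       "{i \<in> {1..2 * n}. neg_rep n t i = 1} = {i \<in> {1..2 * n}. t i = 0}"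
    using v by blast+
  moreover have "neg_rep n t \<in> {1..2 * n} \<rightarrow>\<^sub>E {0, 1}"
    unfolding neg_rep_def by (rule restrict_PiE_iff[THEN iffD2]) (use t in fastforce)
  ultimately show ?thesis using assms unfolding Theta_rep_def by simp
qed

lemma neg_rep_neg_rep:
  assumes "t \<in> Theta_rep n" shows "neg_rep n (neg_rep n t) = t"
proof
  fix i
  have t: "t \<in> {1..2*n} \<rightarrow>\<^sub>E {0,1}" using assms unfolding Theta_rep_def by blast
  show "neg_rep n (neg_rep n t) i = t i"
  proof (cases "i \<in> {1..2*n}")
    case True
    then have "t i \<in> {0,1}" using PiE_mem[OF t] by blast
    then show ?thesis using True by (auto simp: neg_rep_def)
  next
    case False
    then show ?thesis using PiE_arb[OF t False] unfolding neg_rep_def restrict_def by (simp only: if_False)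
  qed
qed

lemma neg_rep_neq:
  assumes "n \<ge> 1" shows "neg_rep n t \<noteq> t"
proof
  assume "neg_rep n t = t"
  then have "neg_rep n t 1 = t 1" by simp
  then show False using assms by (simp add: neg_rep_def) arith
qed

lemma equiv_sim: "equiv (Theta_rep n) (sim n)"
proof (rule equivI)
  show "refl_on (Theta_rep n) (sim n)" by (auto simp: refl_on_def sim_def)
  show "sym (sim n)" by (auto simp: sym_def sim_def neg_rep_neg_rep)
  show "trans (sim n)" by (auto simp: trans_def sim_def neg_rep_neg_rep)
qed (auto simp: sim_def)

lemma sim_class: "t \<in> Theta_rep n \<Longrightarrow> sim n `` {t} = {t, neg_rep n t}"
  by (auto simp: sim_def neg_rep_in)

lemma graph_law_rep_neg:
  assumes "t \<in> Theta_rep n" shows "graph_law_rep n p q (neg_rep n t) = graph_law_rep n p q t"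
proof -
  have *: "(neg_rep n t i = neg_rep n t j) = (t i = t j)" if "(i, j) \<in> vertex_pairs n" for i j
  proof -
    have ij: "i \<in> {1..2 * n}" "j \<in> {1..2 * n}" using that by (auto simp: vertex_pairs_def)
    show ?thesis
      using Theta_rep_values[OF assms ij(1)] Theta_rep_values[OF assms ij(2)] ij
      by (auto simp: neg_rep_def)
  qed
  show ?thesis unfolding graph_law_rep_def
    by (intro arg_cong[where f = "map_pmf (graph_of n)"] Pi_pmf_cong refl)
      (auto simp: *)
qed

lemma graph_law_eq:
  assumes "\<theta> \<in> Theta n" "t \<in> \<theta>" shows "graph_law n p q \<theta> = graph_law_rep n p q t"
proof -
  obtain s where s: "s \<in> Theta_rep n" "\<theta> = {s, neg_rep n s}"
    using assms(1) sim_class unfolding Theta_def by (metis quotientE)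
  have "graph_law_rep n p q u = graph_law_rep n p q s" if "u \<in> \<theta>" for u
    using that s graph_law_rep_neg by auto
  then show ?thesis unfolding graph_law_def using assms(2) by (metis someI)
qed

lemma card_Theta_rep: "card (Theta_rep n) = (2 * n) choose n"
proof -
  let ?I = "{1..2 * n}"
  have "bij_betw (\<lambda>t. {i \<in> ?I. t i = 0}) (Theta_rep n) {S. S \<subseteq> ?I \<and> card S = n}"
  proof (rule bij_betw_byWitness[where f' = "\<lambda>S. restrict (\<lambda>i. if i \<in> S then 0 else 1) ?I"])
    show "\<forall>t\<in>Theta_rep n. restrict (\<lambda>i. if i \<in> {i \<in> ?I. t i = 0} then 0 else 1) ?I = t"
    proof
      fix t assume "t \<in> Theta_rep n"
      then have t: "t \<in> ?I \<rightarrow>\<^sub>E {0,1}" unfolding Theta_rep_def by blast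
      show "restrict (\<lambda>i. if i \<in> {i \<in> ?I. t i = 0} then 0 else 1) ?I = t"
      proof
        fix i show "restrict (\<lambda>i. if i \<in> {i \<in> ?I. t i = 0} then 0 else 1) ?I i = t i"
          using PiE_mem[OF t, of i] PiE_arb[OF t, of i] by (cases "i \<in> ?I") auto
      qed
    qed
    show "\<forall>S\<in>{S. S \<subseteq> ?I \<and> card S = n}.
        {i \<in> ?I. restrict (\<lambda>i. if i \<in> S then 0 else 1) ?I i = (0::nat)} = S"
      by (auto split: if_splits)
    show "(\<lambda>t. {i \<in> ?I. t i = 0}) ` Theta_rep n \<subseteq> {S. S \<subseteq> ?I \<and> card S = n}"
      unfolding Theta_rep_def by auto
    show "(\<lambda>S. restrict (\<lambda>i. if i \<in> S then 0 else 1) ?I) ` {S. S \<subseteq> ?I \<and> card S = n}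
        \<subseteq> Theta_rep n"
    proof (rule image_subsetI)
      fix S assume "S \<in> {S. S \<subseteq> ?I \<and> card S = n}"
      then have S: "S \<subseteq> ?I" "card S = n" by auto
      let ?t = "restrict (\<lambda>i. if i \<in> S then 0 else (1::nat)) ?I"
      have 0: "{i \<in> ?I. ?t i = 0} = S" using S(1) by (auto split: if_splits)
      have 1: "{i \<in> ?I. ?t i = 1} = ?I - S" by (auto split: if_splits)
      have "card (?I - S) = card ?I - card S"
        by (rule card_Diff_subset[OF finite_subset[OF S(1)] S(1)]) simp
      then have "card (?I - S) = n" using S(2) by simp
      moreover have "?t \<in> ?I \<rightarrow>\<^sub>E {0, 1}" by auto
      ultimately show "?t \<in> Theta_rep n"
        unfolding Theta_rep_def mem_Collect_eq 0 1 using S(2) by blast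
    qed
  qed
  then show ?thesis using bij_betw_same_card n_subsets[of ?I n] by fastforce
qed

lemma card_Theta:
  assumes "n \<ge> 1" shows "real (card (Theta n)) = 1/2 * real ((2 * n) choose n)"
proof -
  have "2 * card (Theta n) = card (\<Union> (Theta n))"
  proof (rule card_partition)
    show "finite (Theta n)" unfolding Theta_def 
      by (rule finite_quotient[OF finite_Theta_rep]) (auto simp: sim_def)
    show "finite (\<Union> (Theta n))" unfolding Theta_def
      using Union_quotient[OF equiv_sim] finite_Theta_rep by simp
    fix c assume "c \<in> Theta n"
    then obtain t where "t \<in> Theta_rep n" "c = {t, neg_rep n t}"
      using sim_class unfolding Theta_def by (metis quotientE)
    then show "card c = 2" using neg_rep_neq[OF assms, of t] by auto
  next
    fix c d assume "c \<in> Theta n" "d \<in> Theta n" "c \<noteq> d"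
    then show "c \<inter> d = {}" unfolding Theta_def using quotient_disj[OF equiv_sim] by blast
  qed
  also have "\<dots> = (2 * n) choose n"
    unfolding Theta_def Union_quotient[OF equiv_sim] by (rule card_Theta_rep)
  finally show ?thesis by simp
qed

lemma b_seq_eq: "n \<ge> 1 \<Longrightarrow> b_seq n = inverse (1/2 * real ((2 * n) choose n))"
  by (simp only: b_seq_def card_Theta)

lemma set_graph_law: "set_pmf (graph_law n p q \<theta>) \<subseteq> graphs n"
  by (auto simp: graph_law_def graph_law_rep_def graphs_def graph_of_def vertex_pairs_def)

end

theory Submission
  imports Defs
begin

text \<open>
  Write \<open>w \<theta> x\<close> for the probability of the graph \<open>x\<close> under \<open>\<theta>\<close>. If a credible set at \<open>x\<close> misses
  \<open>\<theta>\<^sub>0\<close>, then the posterior weight of the single point \<open>\<theta>\<^sub>0\<close> is at most the remaining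
  credibility \<open>a\<close>, that is, \<open>w \<theta>\<^sub>0 x \<le> a * (\<Sum>\<theta>. w \<theta> x)\<close>
  (\<open>weight_le_if_outside_credible\<close>). Since the prior is uniform, the sum on the right is
  \<open>card \<Theta>\<close> times the prior predictive probability of \<open>x\<close>. Thus, on the event that \<open>\<theta>\<^sub>0\<close> is not
  covered, the true law is dominated by \<open>card \<Theta> * a\<close> times the prior predictive law, and the
  latter has total mass one; so this event has probability at most \<open>card \<Theta> * a\<close>, where
  \<open>card \<Theta>\<close> is the inverse of the uniform prior mass of \<open>\<theta>\<^sub>0\<close>.

  The comparison is made for an arbitrary finite family of discrete laws
  (\<open>coverage_ge_of_credible\<close>). Credibility holds only almost surely under the prior predictive
  law; this suffices because that law charges every graph that is possible under \<open>\<theta>\<^sub>0\<close>.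
\<close>

text \<open>
  The weight outside \<open>A\<close> is the total weight minus the weight of \<open>A\<close>, and it
  bounds the weight of each single point outside \<open>A\<close>.
\<close>

lemma weight_le_if_outside_credible:
  fixes w :: "'i \<Rightarrow> real"
  assumes "finite T" "A \<subseteq> T" "i \<in> T" "i \<notin> A"
    and nonneg: "\<And>j. j \<in> T \<Longrightarrow> 0 \<le> w j"
    and pos: "0 < sum w T"
    and cred: "sum w A / sum w T \<ge> 1 - a"
  shows "w i \<le> a * sum w T"
proof -
  have "w i + sum w A = sum w (insert i A)"
    using assms(1-4) finite_subset by (subst sum.insert) auto
  also have "\<dots> \<le> sum w T"
    using assms(1-3) nonneg by (intro sum_mono2) auto
  finally have "w i + sum w A \<le> sum w T" .
  moreover have "(1 - a) * sum w T \<le> sum w A"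
    using cred pos by (simp add: pos_le_divide_eq)
  ultimately show ?thesis by (simp add: algebra_simps)
qed

lemma prob_le_mult_prob_of_pmf_le:
  assumes "\<And>x. x \<in> B \<Longrightarrow> pmf P x \<le> c * pmf Q x"
  shows "measure_pmf.prob P B \<le> c * measure_pmf.prob Q B"
proof -
  have "infsetsum (pmf P) B \<le> infsetsum (\<lambda>x. c * pmf Q x) B"
    using assms
    by (intro infsetsum_mono abs_summable_on_cmult_right pmf_abs_summable) auto
  then show ?thesis
    by (simp add: measure_pmf_conv_infsetsum infsetsum_cmult_right pmf_abs_summable)
qed

text \<open>
  Under a uniform prior, a credible set of level \<open>1 - a\<close> covers each individual parameter with
  probability at least \<open>1 - card T * a\<close>. The assumptions on \<open>D\<close> refer only to observations that
  are possible under \<open>i\<close>: the others contribute nothing to the probability of missing \<open>i\<close>.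
\<close>

lemma coverage_ge_of_credible:
  fixes K :: "'i \<Rightarrow> 'a pmf"
  assumes "finite T" "i \<in> T" "0 \<le> a"
    and sub: "\<And>x. x \<in> set_pmf (K i) \<Longrightarrow> D x \<subseteq> T"
    and cred: "\<And>x. x \<in> set_pmf (K i) \<Longrightarrow>
      (\<Sum>j\<in>D x. pmf (K j) x) / (\<Sum>j\<in>T. pmf (K j) x) \<ge> 1 - a"
  shows "measure_pmf.prob (K i) {x. i \<in> D x} \<ge> 1 - real (card T) * a"
proof -
  let ?B = "{x. i \<notin> D x}"
  let ?M = "pmf_of_set T \<bind> K"
  have "T \<noteq> {}" and card: "0 < real (card T)"
    using assms(1,2) card_gt_0_iff by auto
  have mix: "(\<Sum>j\<in>T. pmf (K j) x) = real (card T) * pmf ?M x" for x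
    using \<open>T \<noteq> {}\<close> card assms(1) by (simp add: pmf_bind_pmf_of_set)
  have "pmf (K i) x \<le> (real (card T) * a) * pmf ?M x" if "x \<in> ?B" for x
  proof (cases "x \<in> set_pmf (K i)")
    case True
    have "0 < pmf (K i) x"
      using True by (simp add: pmf_positive)
    also have "\<dots> \<le> (\<Sum>j\<in>T. pmf (K j) x)"
      using assms(1,2) by (intro member_le_sum) auto
    finally have "pmf (K i) x \<le> a * (\<Sum>j\<in>T. pmf (K j) x)"
      using that assms(1,2) sub[OF True] cred[OF True]
      by (intro weight_le_if_outside_credible) auto
    then show ?thesis by (simp add: mix mult_ac)
  next
    case False
    then show ?thesis using \<open>0 \<le> a\<close> by (simp add: set_pmf_iff)
  qed
  then have "measure_pmf.prob (K i) ?B \<le> (real (card T) * a) * measure_pmf.prob ?M ?B"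
    by (rule prob_le_mult_prob_of_pmf_le)
  also have "\<dots> \<le> real (card T) * a"
    using \<open>0 \<le> a\<close> by (intro mult_left_le) auto
  finally have "measure_pmf.prob (K i) ?B \<le> real (card T) * a" .
  moreover have "measure_pmf.prob (K i) ?B = 1 - measure_pmf.prob (K i) {x. i \<in> D x}"
    using measure_pmf.prob_compl[of "{x. i \<in> D x}" "K i"]
    by (simp add: Compl_eq_Diff_UNIV[symmetric] Collect_neg_eq)
  ultimately show ?thesis by simp
qed

lemma finite_Theta: "finite (Theta n)"
  unfolding Theta_def by (rule finite_quotient[OF finite_Theta_rep]) (auto simp: sim_def)

theorem proposition4p3:
  fixes p q a :: "nat \<Rightarrow> real"
    and \<theta>\<^sub>0 :: "nat \<Rightarrow> (nat \<Rightarrow> nat) set"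
    and D :: "nat \<Rightarrow> nat set set \<Rightarrow> (nat \<Rightarrow> nat) set set"
  assumes "\<And>n. n \<ge> 1 \<Longrightarrow> 0 < p n \<and> p n < 1"
    and "\<And>n. n \<ge> 1 \<Longrightarrow> 0 < q n \<and> q n < 1"
    and "\<And>n. n \<ge> 1 \<Longrightarrow> \<theta>\<^sub>0 n \<in> Theta n"
    and "\<And>n x. n \<ge> 1 \<Longrightarrow> x \<in> graphs n \<Longrightarrow> D n x \<subseteq> Theta n"
    and "\<And>n. n \<ge> 1 \<Longrightarrow>
           AE x in measure_pmf (prior_predictive n (p n) (q n)).
             posterior n (p n) (q n) x (D n x) \<ge> 1 - a n"
    and "\<And>n. n \<ge> 1 \<Longrightarrow> 0 \<le> a n \<and> a n \<le> 1"
    and "a \<in> o(b_seq)"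
  shows "\<forall>n\<ge>1. measure_pmf.prob (graph_law n (p n) (q n) (\<theta>\<^sub>0 n)) {x. \<theta>\<^sub>0 n \<in> D n x}
           \<ge> 1 - inverse (b_seq n) * a n"
proof (intro allI impI)
  fix n :: nat
  assume n: "n \<ge> 1"
  let ?K = "graph_law n (p n) (q n)"
  have \<theta>\<^sub>0: "\<theta>\<^sub>0 n \<in> Theta n" using assms(3)[OF n] .
  have "set_pmf (?K (\<theta>\<^sub>0 n)) \<subseteq> set_pmf (prior_predictive n (p n) (q n))"
    using \<theta>\<^sub>0 finite_Theta unfolding prior_predictive_def
    by (subst set_bind_pmf, subst set_pmf_of_set) auto
  then have cred: "posterior n (p n) (q n) x (D n x) \<ge> 1 - a n"
    if "x \<in> set_pmf (?K (\<theta>\<^sub>0 n))" for x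
    using assms(5)[OF n] that by (auto simp: AE_measure_pmf_iff)
  have "measure_pmf.prob (?K (\<theta>\<^sub>0 n)) {x. \<theta>\<^sub>0 n \<in> D n x} \<ge> 1 - real (card (Theta n)) * a n"
  proof (rule coverage_ge_of_credible[OF finite_Theta \<theta>\<^sub>0])
    show "0 \<le> a n" using assms(6)[OF n] by simp
    show "D n x \<subseteq> Theta n" if "x \<in> set_pmf (?K (\<theta>\<^sub>0 n))" for x
      using that set_graph_law assms(4)[OF n] by blast
  qed (use cred in \<open>simp add: posterior_def\<close>)
  then show "measure_pmf.prob (?K (\<theta>\<^sub>0 n)) {x. \<theta>\<^sub>0 n \<in> D n x} \<ge> 1 - inverse (b_seq n) * a n"
    by (simp add: b_seq_def)
qed

end
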